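(* Let $K=\mathrm{GF}(2)$, let $V$ be a finite dimensional vector space over $K$, let $f:V\to V$ be a nilpotent $K$-linear map with elementary divisors $\lambda^{t_1},\dots,\lambda^{t_m}$, $0<t_1\le\cdots\le t_m$, and let $U=(u_1,\dots,u_m)$ be a generator tuple of $V$ with respect to $f$. Let $J=\{i_1,\dots,i_k\}\subseteq I_u$ with $i_1<\cdots<i_k$ and $2\le k$. Assume $$t_{i_s}+1<t_{i_{s+1}},\quad s=1,\dots,k-1.$$ Let $\vec\mu=(\mu_1,\dots,\mu_m)$ and $\vec r=(r_1,\dots,r_m)$ be elements of $\mathcal L(\vec t\,)$ such that $$0\le\mu_{i_1}<\cdots<\mu_{i_k}\quad\text{and}\quad 0<t_{i_1}-\mu_{i_1}<\cdots<t_{i_k}-\mu_{i_k}$$ and $$\vec r=\vec\mu+\sum_{s=1}^k\vec e_{i_s}.$$ Set $D_{\vec\mu_J}=\mathrm{span}\{f^{\mu_{i_1}}u_{i_1},\dots,f^{\mu_{i_k}}u_{i_k}\}$. Then: (i) Each subspace $X\in[W(\vec r),W(\vec\mu)]$ is characteristic. Moreover, $X\in[W(\vec r),W(\vec\mu)]$ if and only if $X=W(\vec r)\oplus Z$ for some subspace $Z\subseteq D_{\vec\mu_J}$. (ii) A subspace $X\in[W(\vec r),W(\vec\mu)]$ is hyperinvariant if and only if $$X=W(\vec r)\oplus\mathrm{span}\{f^{\mu_{\tau_1}}u_{\tau_1},\dots,f^{\mu_{\tau_q}}u_{\tau_q}\}$$ for some (possibly empty) subset $T=\{\tau_1,\dots,\tau_q\}$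 of $J$.
   Context: A subspace of $V$ is hyperinvariant if it is invariant under all endomorphisms of $V$ that commute with $f$. It is characteristic if it is $f$-invariant and invariant under all automorphisms of $V$ that commute with $f$. For $f$-invariant subspaces $A\subseteq B$, $[A,B]$ denotes the set of all $f$-invariant subspaces $C$ with $A\subseteq C\subseteq B$. For $x\in V$, $\langle x\rangle=\mathrm{span}\{f^ix:\ i\ge0\}$, and the exponent $\mathrm e(x)$ is the smallest integer $\ell\ge0$ with $f^\ell x=0$. A generator tuple is a tuple $U=(u_1,\dots,u_m)$ of elements of $V$ with $V=\langle u_1\rangle\oplus\cdots\oplus\langle u_m\rangle$ and $\mathrm e(u_j)=t_j$ for $j=1,\dots,m$. $I_u=\{i:\ t_i\ne t_k\text{ for all }k\ne i,\ 1\le k\le m\}$ is the set of indices of unrepeated exponents. $\vec t=(t_1,\dots,t_m)$, and $\mathcal L(\vec t\,)$ is the set of integer $m$-tuples $\vec r=(r_1,\dots,r_m)$ with $0\le r_1\le\cdots\le r_m$ and $0\le t_1-r_1\le\cdots\le t_m-r_m$. For $\vec r\in\mathcal L(\vec t\,)$, $W(\vec r)=\sum_{j=1}^m\big(f^{r_j}V\cap\mathrm{Ker}f^{t_j-r_j}\big)$. It is known that $W(\vec r)=\langle f^{r_1}u_1\rangle\oplus\cdots\oplus\langle f^{r_m}u_m\rangle$ for every generator tuple, and that $\vec r\mapsto W(\vec r)$ is a bijection from $\mathcal L(\vec t\,)$ onto the set of hyperinvariant subspaces. $\vec e_1,\dots,\vec e_m$ are the standard unit row vectors of size $m$. *)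

theory Defs
  imports
    "HOL-Library.Z2"
    "HOL-Library.Set_Algebras"
    "HOL-Computational_Algebra.Polynomial"
begin

text \<open>
  The vector space \<open>V\<close> is the whole type \<open>'v\<close>, with scalar multiplication \<open>scale\<close>.
  An \<open>m\<close>-tuple is a function on \<open>nat\<close> of which only the values at \<open>1, \<dots>, m\<close> matter.
  Sums \<open>A + B\<close> and \<open>\<Sum>j\<in>I. A j\<close> of subspaces are the elementwise sums of
  \<^theory>\<open>HOL-Library.Set_Algebras\<close>.
\<close>

definition direct_sum :: "'i set \<Rightarrow> ('i \<Rightarrow> 'v::ab_group_add set) \<Rightarrow> 'v set \<Rightarrow> bool" where
  "direct_sum I A X \<longleftrightarrow>
     X = (\<Sum>i\<in>I. A i) \<and>
     (\<forall>a. (\<forall>i\<in>I. a i \<in> A i) \<longrightarrow> (\<Sum>i\<in>I. a i) = 0 \<longrightarrow> (\<forall>i\<in>I. a i = 0))"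

definition direct_sum2 :: "'v::ab_group_add set \<Rightarrow> 'v set \<Rightarrow> 'v set \<Rightarrow> bool" where
  "direct_sum2 A B X \<longleftrightarrow> X = A + B \<and> A \<inter> B = {0}"

definition nilpotent :: "('v::ab_group_add \<Rightarrow> 'v) \<Rightarrow> bool" where
  "nilpotent f \<longleftrightarrow> (\<exists>n. \<forall>x. (f ^^ n) x = 0)"

definition invariant_subspace ::
  "('a::field \<Rightarrow> 'v::ab_group_add \<Rightarrow> 'v) \<Rightarrow> ('v \<Rightarrow> 'v) \<Rightarrow> 'v set \<Rightarrow> bool" where
  "invariant_subspace scale f X \<longleftrightarrow> module.subspace scale X \<and> f ` X \<subseteq> X"

definition hyperinvariant ::
  "('a::field \<Rightarrow> 'v::ab_group_add \<Rightarrow> 'v) \<Rightarrow> ('v \<Rightarrow> 'v) \<Rightarrow> 'v set \<Rightarrow> bool" where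
  "hyperinvariant scale f X \<longleftrightarrow> module.subspace scale X \<and>
     (\<forall>g. Vector_Spaces.linear scale scale g \<and> g \<circ> f = f \<circ> g \<longrightarrow> g ` X \<subseteq> X)"

definition characteristic ::
  "('a::field \<Rightarrow> 'v::ab_group_add \<Rightarrow> 'v) \<Rightarrow> ('v \<Rightarrow> 'v) \<Rightarrow> 'v set \<Rightarrow> bool" where
  "characteristic scale f X \<longleftrightarrow> invariant_subspace scale f X \<and>
     (\<forall>g. Vector_Spaces.linear scale scale g \<and> bij g \<and> g \<circ> f = f \<circ> g \<longrightarrow> g ` X \<subseteq> X)"

definition inv_interval ::
  "('a::field \<Rightarrow> 'v::ab_group_add \<Rightarrow> 'v) \<Rightarrow> ('v \<Rightarrow> 'v) \<Rightarrow> 'v set \<Rightarrow> 'v set \<Rightarrow> 'v set set" where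
  "inv_interval scale f A B = {C. invariant_subspace scale f C \<and> A \<subseteq> C \<and> C \<subseteq> B}"

definition cyclic_subspace ::
  "('a::field \<Rightarrow> 'v::ab_group_add \<Rightarrow> 'v) \<Rightarrow> ('v \<Rightarrow> 'v) \<Rightarrow> 'v \<Rightarrow> 'v set" where
  "cyclic_subspace scale f x = module.span scale (range (\<lambda>i. (f ^^ i) x))"

text \<open>Only meaningful if some power of \<open>f\<close> annihilates \<open>x\<close>, e.g. for nilpotent \<open>f\<close>.\<close>

definition exponent :: "('v::ab_group_add \<Rightarrow> 'v) \<Rightarrow> 'v \<Rightarrow> nat" where
  "exponent f x = (LEAST l. (f ^^ l) x = 0)"

definition poly_action ::
  "('a::field \<Rightarrow> 'v::ab_group_add \<Rightarrow> 'v) \<Rightarrow> ('v \<Rightarrow> 'v) \<Rightarrow> 'a poly \<Rightarrow> 'v \<Rightarrow> 'v" where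
  "poly_action scale f p x = (\<Sum>i\<le>degree p. scale (coeff p i) ((f ^^ i) x))"

text \<open>
  \<open>V\<close>, as a module over the polynomial ring on which the indeterminate acts as \<open>f\<close>, is the
  direct sum of cyclic submodules whose annihilators are generated by the prime powers
  \<open>p 1, \<dots>, p m\<close>.
\<close>

definition elementary_divisors ::
  "('a::field \<Rightarrow> 'v::ab_group_add \<Rightarrow> 'v) \<Rightarrow> ('v \<Rightarrow> 'v) \<Rightarrow> nat \<Rightarrow> (nat \<Rightarrow> 'a poly) \<Rightarrow> bool" where
  "elementary_divisors scale f m p \<longleftrightarrow>
     (\<forall>j\<in>{1..m}. \<exists>q n. irreducible q \<and> lead_coeff q = 1 \<and> 0 < n \<and> p j = q ^ n) \<and>
     (\<exists>v. direct_sum {1..m} (\<lambda>j. cyclic_subspace scale f (v j)) UNIV \<and>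
          (\<forall>j\<in>{1..m}. \<forall>q. poly_action scale f q (v j) = 0 \<longleftrightarrow> p j dvd q))"

definition generator_tuple ::
  "('a::field \<Rightarrow> 'v::ab_group_add \<Rightarrow> 'v) \<Rightarrow> ('v \<Rightarrow> 'v) \<Rightarrow> nat \<Rightarrow> (nat \<Rightarrow> nat) \<Rightarrow> (nat \<Rightarrow> 'v) \<Rightarrow> bool" where
  "generator_tuple scale f m t u \<longleftrightarrow>
     direct_sum {1..m} (\<lambda>j. cyclic_subspace scale f (u j)) UNIV \<and>
     (\<forall>j\<in>{1..m}. exponent f (u j) = t j)"

definition unrepeated :: "nat \<Rightarrow> (nat \<Rightarrow> nat) \<Rightarrow> nat set" where
  "unrepeated m t = {i \<in> {1..m}. \<forall>k\<in>{1..m}. k \<noteq> i \<longrightarrow> t i \<noteq> t k}"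

text \<open>
  The bound \<open>r j \<le> t j\<close> expresses that the differences are nonnegative as integers, so the
  subtraction on \<open>nat\<close> is exact.
\<close>

definition hyper_tuples :: "nat \<Rightarrow> (nat \<Rightarrow> nat) \<Rightarrow> (nat \<Rightarrow> nat) set" where
  "hyper_tuples m t = {r. mono_on {1..m} r \<and> (\<forall>j\<in>{1..m}. r j \<le> t j) \<and>
                          mono_on {1..m} (\<lambda>j. t j - r j)}"

definition W_space ::
  "('v::ab_group_add \<Rightarrow> 'v) \<Rightarrow> nat \<Rightarrow> (nat \<Rightarrow> nat) \<Rightarrow> (nat \<Rightarrow> nat) \<Rightarrow> 'v set" where
  "W_space f m t r = (\<Sum>j\<in>{1..m}. range (f ^^ r j) \<inter> {x. (f ^^ (t j - r j)) x = 0})"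

definition unit_tuple :: "nat \<Rightarrow> nat \<Rightarrow> nat" where
  "unit_tuple i = (\<lambda>j. if j = i then 1 else 0)"

end

(* Write C j n for the cyclic subspace generated by f^n u_j; then W(r) consists of the x whose j-th
   component lies in C j (r j) for all j.  Put d_s = f^(mu_s) u_s for s in J, so that W(mu) is the
   direct sum of W(r) and the span of the d_s, and f maps W(mu) into W(r).  If g commutes with f, then
   g d_s lies in the range of f^(mu_s) and in the kernel of f^(t_s - mu_s), and the strict
   inequalities force g d_s = c d_s modulo W(r) for a scalar c.  Applying the inverse of g, which
   preserves W(r), shows that c is nonzero if g is bijective; over GF(2) this means c = 1, so
   automorphisms act trivially on W(mu) / W(r) and every subspace in between is characteristic.
   A hyperinvariant X is preserved by the projections onto the cyclic summands, hence contains d_s as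
   soon as d_s occurs in one of its elements. *)

theory Submission
  imports Defs
begin

section \<open>Cyclic subspaces of a nilpotent endomorphism\<close>

locale nilpotent_endomorphism = vector_space scale
  for scale :: "'a::field \<Rightarrow> 'v::ab_group_add \<Rightarrow> 'v" (infixr \<open>*s\<close> 75) +
  fixes f :: "'v \<Rightarrow> 'v"
  assumes linear_f: "Vector_Spaces.linear scale scale f"
    and nilpotent_f: "nilpotent f"
begin

sublocale f: Vector_Spaces.linear scale scale f
  by (rule linear_f)

abbreviation cyc :: "'v \<Rightarrow> 'v set" where
  "cyc \<equiv> cyclic_subspace scale f"

lemma linear_funpow: "Vector_Spaces.linear scale scale (f ^^ n)"
proof (induction n)
  case 0
  show ?case using linear_id by (simp add: id_def)
next
  case (Suc n)
  show ?case using Vector_Spaces.linear_compose[OF Suc linear_f] by (simp add: comp_def)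
qed

sublocale funpow: Vector_Spaces.linear scale scale "f ^^ n" for n
  by (rule linear_funpow)

lemma funpow_commute:
  assumes "g \<circ> f = f \<circ> g"
  shows "g ((f ^^ n) x) = (f ^^ n) (g x)"
  using assms by (induction n) (simp_all add: fun_eq_iff)

lemma funpow_add_apply: "(f ^^ a) ((f ^^ b) x) = (f ^^ (a + b)) x"
  by (simp add: funpow_add)

lemma subspace_cyc [simp]: "subspace (cyc x)"
  by (simp add: cyclic_subspace_def)

lemma funpow_in_cyc: "(f ^^ n) x \<in> cyc x"
  unfolding cyclic_subspace_def by (intro span_base rangeI)

lemma self_in_cyc [simp]: "x \<in> cyc x"
  using funpow_in_cyc[of 0 x] by simp

lemma funpow_image_cyc: "(f ^^ k) ` cyc x = cyc ((f ^^ k) x)"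
  unfolding cyclic_subspace_def funpow.span_image[symmetric] image_image
  by (simp add: funpow_add_apply add.commute)

lemma funpow_mem_cyc: "y \<in> cyc x \<Longrightarrow> (f ^^ k) y \<in> cyc ((f ^^ k) x)"
  using funpow_image_cyc by blast

lemma cyc_zero [simp]: "cyc 0 = {0}"
  by (simp add: cyclic_subspace_def)

lemma cyc_funpow_antimono:
  assumes "a \<le> b"
  shows "cyc ((f ^^ b) x) \<subseteq> cyc ((f ^^ a) x)"
  unfolding cyclic_subspace_def
proof (rule span_mono, clarify)
  fix n
  have "(f ^^ n) ((f ^^ b) x) = (f ^^ (n + (b - a))) ((f ^^ a) x)"
    using assms by (simp add: funpow_add_apply)
  then show "(f ^^ n) ((f ^^ b) x) \<in> range (\<lambda>n. (f ^^ n) ((f ^^ a) x))"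
    by blast
qed

lemma f_mem_cyc: "y \<in> cyc x \<Longrightarrow> f y \<in> cyc x"
  using funpow_mem_cyc[of y x 1] cyc_funpow_antimono[of 0 1 x] by auto

lemma cyc_minimal:
  assumes "subspace S" "f ` S \<subseteq> S" "x \<in> S"
  shows "cyc x \<subseteq> S"
  unfolding cyclic_subspace_def
proof (rule span_minimal)
  have "(f ^^ n) x \<in> S" for n
    using assms by (induction n) auto
  then show "range (\<lambda>n. (f ^^ n) x) \<subseteq> S" by auto
qed (rule assms)

text \<open>\<open>cyc x\<close> is spanned by the vectors \<open>(f ^^ n) x\<close>; those with
  \<open>n > 0\<close> lie in \<open>cyc (f x)\<close>, so only \<open>n = 0\<close> contributes to
  \<open>c\<close>.\<close>

lemma cyc_leading_term:
  assumes "y \<in> cyc x"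
  obtains c where "y - c *s x \<in> cyc (f x)"
proof -
  have "\<exists>c. y - c *s x \<in> cyc (f x)"
    using assms unfolding cyclic_subspace_def[of _ _ x]
  proof (induction rule: span_induct_alt)
    case base
    have "0 - 0 *s x \<in> cyc (f x)" by (simp add: subspace_0)
    then show ?case by blast
  next
    case (step a b y)
    then obtain n c where b: "b = (f ^^ n) x" and c: "y - c *s x \<in> cyc (f x)" by auto
    show ?case
    proof (cases n)
      case 0
      have "a *s b + y - (a + c) *s x \<in> cyc (f x)"
        using c by (simp add: b 0 algebra_simps)
      then show ?thesis by blast
    next
      case (Suc k)
      have "b = (f ^^ k) (f x)" by (simp add: b Suc funpow_swap1)
      then have "a *s b + (y - c *s x) \<in> cyc (f x)"
        by (intro subspace_add[OF subspace_cyc] subspace_scale[OF subspace_cyc] c)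
          (simp add: funpow_in_cyc)
      then show ?thesis by (auto simp: add_diff_eq)
    qed
  qed
  then show ?thesis using that by blast
qed

text \<open>Membership would iterate to \<open>x \<in> cyc ((f ^^ n) x)\<close> for every
  \<open>n\<close>, and by nilpotency this cyclic subspace is eventually zero.\<close>

lemma self_notin_cyc_image:
  assumes "x \<noteq> 0"
  shows "x \<notin> cyc (f x)"
proof
  assume x: "x \<in> cyc (f x)"
  have mem: "x \<in> cyc ((f ^^ n) x)" for n
  proof (induction n)
    case (Suc n)
    have "f x \<in> cyc ((f ^^ Suc n) x)"
      using funpow_mem_cyc[OF Suc, of 1] by simp
    then have "cyc (f x) \<subseteq> cyc ((f ^^ Suc n) x)"
      by (intro cyc_minimal) (auto intro: f_mem_cyc)
    with x show ?case by blast
  qed simp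
  obtain n where "(f ^^ n) x = 0"
    using nilpotent_f unfolding nilpotent_def by blast
  then show False using mem[of n] assms by simp
qed

text \<open>Induction on \<open>n\<close> improves the membership of \<open>y\<close> one power at a
  time. The leading coefficient of \<open>y\<close> at \<open>(f ^^ n) x\<close> is also that of
  \<open>(f ^^ k) y\<close> at \<open>(f ^^ (n + k)) x\<close>; as the latter vector is nonzero,
  \<open>self_notin_cyc_image\<close> forces the coefficient to vanish.\<close>

lemma funpow_cyc_cancel:
  assumes "y \<in> cyc x" "(f ^^ k) y \<in> cyc ((f ^^ (n + k)) x)"
    and "\<And>l. l < n + k \<Longrightarrow> (f ^^ l) x \<noteq> 0"
  shows "y \<in> cyc ((f ^^ n) x)"
  using assms
proof (induction n)
  case (Suc n)
  have "cyc ((f ^^ (Suc n + k)) x) \<subseteq> cyc ((f ^^ (n + k)) x)"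
    by (rule cyc_funpow_antimono) simp
  with Suc have "y \<in> cyc ((f ^^ n) x)" by auto
  then obtain c where c: "y - c *s (f ^^ n) x \<in> cyc ((f ^^ Suc n) x)"
    by (metis cyc_leading_term funpow.simps(2) comp_apply)
  let ?v = "(f ^^ (n + k)) x"
  have "(f ^^ k) (y - c *s (f ^^ n) x) \<in> cyc ((f ^^ (Suc n + k)) x)"
    using funpow_mem_cyc[OF c, of k] by (simp only: funpow_add_apply add.commute)
  then have "(f ^^ k) y - (f ^^ k) (y - c *s (f ^^ n) x) \<in> cyc (f ?v)"
    using Suc.prems(2) by (auto intro: subspace_diff[OF subspace_cyc])
  then have v: "c *s ?v \<in> cyc (f ?v)"
    by (simp add: funpow.diff funpow.scale funpow_add_apply add.commute)
  have "c = 0"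
  proof (rule ccontr)
    assume "c \<noteq> 0"
    then have "?v \<in> cyc (f ?v)"
      using subspace_scale[OF subspace_cyc v, of "inverse c"] by simp
    moreover have "?v \<noteq> 0" using Suc.prems(3) by simp
    ultimately show False using self_notin_cyc_image by blast
  qed
  with c show ?case by simp
qed simp

end

text \<open>Coefficients are indexed by \<open>T\<close> and not by the vectors, so that they match
  the components indexed by \<open>J\<close>. Adding a multiple of a spanning vector changes the
  coefficient at one chosen preimage only, which works for any \<open>d\<close>.\<close>

lemma (in vector_space) in_span_image_finite:
  assumes "finite T" "x \<in> span (d ` T)"
  obtains c where "x = (\<Sum>s\<in>T. c s *s d s)"
proof -
  have "\<exists>c. x = (\<Sum>s\<in>T. c s *s d s)"
    using assms(2)
  proof (induction rule: span_induct_alt)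
    case base
    show ?case by (rule exI[where x = "\<lambda>_. 0"]) simp
  next
    case (step a b y)
    then obtain s c where s: "s \<in> T" "b = d s" and y: "y = (\<Sum>s\<in>T. c s *s d s)" by blast
    have "a *s b + y = (\<Sum>l\<in>T. ((if l = s then a else 0) + c l) *s d l)"
      using assms(1) s by (simp add: scale_left_distrib sum.distrib y if_distrib[of "\<lambda>a. a *s _"]
          cong: if_cong)
    then show ?case by (rule exI[where x = "\<lambda>l. (if l = s then a else 0) + c l"])
  qed
  then show ?thesis using that by blast
qed

section \<open>Components with respect to a generator tuple\<close>

locale generated_endomorphism = nilpotent_endomorphism scale f
  for scale :: "'a::field \<Rightarrow> 'v::ab_group_add \<Rightarrow> 'v" (infixr \<open>*s\<close> 75)
    and f :: "'v \<Rightarrow> 'v" +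
  fixes m :: nat and t :: "nat \<Rightarrow> nat" and u :: "nat \<Rightarrow> 'v"
  assumes generators: "generator_tuple scale f m t u"
begin

declare One_nat_def [simp del]

lemma funpow_exponent: "j \<in> {1..m} \<Longrightarrow> (f ^^ t j) (u j) = 0"
proof -
  assume j: "j \<in> {1..m}"
  obtain n where "(f ^^ n) (u j) = 0"
    using nilpotent_f unfolding nilpotent_def by blast
  then have "(f ^^ exponent f (u j)) (u j) = 0"
    unfolding exponent_def by (rule LeastI)
  then show ?thesis using generators j by (simp add: generator_tuple_def)
qed

lemma funpow_below_exponent: "j \<in> {1..m} \<Longrightarrow> n < t j \<Longrightarrow> (f ^^ n) (u j) \<noteq> 0"
  using generators not_less_Least[of n "\<lambda>l. (f ^^ l) (u j) = 0"]
  by (auto simp: generator_tuple_def exponent_def)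

text \<open>For \<open>j\<close> in \<open>{1..m}\<close> these subspaces filter the
  \<open>j\<close>-th cyclic summand: they decrease strictly from \<open>C j 0\<close>, the whole
  summand, to zero at \<open>n = t j\<close>.\<close>

definition C :: "nat \<Rightarrow> nat \<Rightarrow> 'v set" where
  "C j n = cyc ((f ^^ n) (u j))"

lemma subspace_C [simp]: "subspace (C j n)"
  by (simp add: C_def)

lemma generator_in_C: "(f ^^ n) (u j) \<in> C j n"
  by (simp add: C_def)

lemma C_antimono: "a \<le> b \<Longrightarrow> C j b \<subseteq> C j a"
  unfolding C_def by (rule cyc_funpow_antimono)

lemma C_exponent: "j \<in> {1..m} \<Longrightarrow> C j (t j) = {0}"
  by (simp add: C_def funpow_exponent)

lemma funpow_image_C: "(f ^^ k) ` C j n = C j (k + n)"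
  by (simp add: C_def funpow_image_cyc funpow_add_apply)

lemma f_mem_C: "y \<in> C j n \<Longrightarrow> f y \<in> C j (Suc n)"
  using funpow_mem_cyc[of y _ 1] by (auto simp: C_def One_nat_def)

lemma C_leading_term:
  assumes "y \<in> C j n"
  obtains c where "y - c *s (f ^^ n) (u j) \<in> C j (Suc n)"
  using assms cyc_leading_term unfolding C_def by auto

text \<open>Complements \<open>C_leading_term\<close>: below the exponent the leading coefficient is
  determined uniquely, since \<open>(f ^^ n) (u j)\<close> is nonzero and so lies outside
  \<open>C j (Suc n)\<close>.\<close>

lemma C_leading_coeff_zero:
  assumes "j \<in> {1..m}" "n < t j" "c *s (f ^^ n) (u j) \<in> C j (Suc n)"
  shows "c = 0"
proof (rule ccontr)
  assume "c \<noteq> 0"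
  then have "(f ^^ n) (u j) \<in> C j (Suc n)"
    using subspace_scale[OF subspace_C assms(3), of "inverse c"] by simp
  then show False
    using self_notin_cyc_image[OF funpow_below_exponent[OF assms(1,2)]] by (simp add: C_def)
qed

text \<open>Cancellation of \<open>f ^^ b\<close> applies because zero lies in every cyclic
  subspace. For \<open>b > t j\<close> the truncated difference is 0 and the claim is the assumption
  itself.\<close>

lemma C_killed:
  assumes "j \<in> {1..m}" "y \<in> C j 0" "(f ^^ b) y = 0"
  shows "y \<in> C j (t j - b)"
proof (cases "b \<le> t j")
  case True
  have "y \<in> cyc ((f ^^ (t j - b)) (u j))"
  proof (rule funpow_cyc_cancel[where k = b])
    show "y \<in> cyc (u j)" using assms(2) by (simp add: C_def)
    show "(f ^^ b) y \<in> cyc ((f ^^ (t j - b + b)) (u j))"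
      by (simp add: assms(3) subspace_0)
    show "(f ^^ l) (u j) \<noteq> 0" if "l < t j - b + b" for l
      using that True assms(1) by (simp add: funpow_below_exponent)
  qed
  then show ?thesis by (simp add: C_def)
qed (use assms in simp)

lemma components_exist: "\<exists>a. (\<forall>j\<in>{1..m}. a j \<in> C j 0) \<and> x = (\<Sum>j\<in>{1..m}. a j)"
proof -
  have "UNIV = (\<Sum>j\<in>{1..m}. C j 0)"
    using generators by (simp add: generator_tuple_def direct_sum_def C_def)
  then have "x \<in> (\<Sum>j\<in>{1..m}. C j 0)" by blast
  then show ?thesis by (auto simp: set_sum_alt)
qed

text \<open>The choice selects a whole family of components of \<open>x\<close> at once and then
  evaluates it at \<open>j\<close>. That the family is the only one on \<open>{1..m}\<close> follows
  from directness in \<open>proj_unique\<close>.\<close>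

definition proj :: "nat \<Rightarrow> 'v \<Rightarrow> 'v" where
  "proj j x = (SOME a. (\<forall>j\<in>{1..m}. a j \<in> C j 0) \<and> x = (\<Sum>j\<in>{1..m}. a j)) j"

lemma proj_in_C: "j \<in> {1..m} \<Longrightarrow> proj j x \<in> C j 0"
  and sum_proj: "(\<Sum>j\<in>{1..m}. proj j x) = x"
  unfolding proj_def using someI_ex[OF components_exist[of x]] by auto

lemma proj_unique:
  assumes "\<And>j. j \<in> {1..m} \<Longrightarrow> a j \<in> C j 0" "x = (\<Sum>j\<in>{1..m}. a j)" "j \<in> {1..m}"
  shows "proj j x = a j"
proof -
  let ?b = "\<lambda>j. proj j x - a j"
  have "\<forall>j\<in>{1..m}. ?b j \<in> cyclic_subspace scale f (u j)"
    using proj_in_C assms(1) subspace_diff[OF subspace_C, of _ _ 0] by (simp add: C_def)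
  moreover have "(\<Sum>j\<in>{1..m}. ?b j) = 0"
    using sum_proj[of x] assms(2) by (simp add: sum_subtractf)
  ultimately have "\<forall>j\<in>{1..m}. ?b j = 0"
    using generators[unfolded generator_tuple_def direct_sum_def, THEN conjunct1, THEN conjunct2,
        rule_format, of ?b]
    by blast
  then show ?thesis using assms(3) by simp
qed

lemma proj_add: "j \<in> {1..m} \<Longrightarrow> proj j (x + y) = proj j x + proj j y"
  by (rule proj_unique)
    (simp_all only: sum.distrib sum_proj subspace_add[OF subspace_C] proj_in_C)

lemma proj_scale: "j \<in> {1..m} \<Longrightarrow> proj j (c *s x) = c *s proj j x"
  by (rule proj_unique)
    (simp_all only: scale_sum_right[symmetric] sum_proj subspace_scale[OF subspace_C] proj_in_C)

text \<open>Each cyclic summand is invariant under \<open>f\<close>, so applying \<open>f\<close>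
  termwise to the decomposition of \<open>x\<close> yields the decomposition of \<open>f x\<close>.
  Thus the projections are themselves endomorphisms commuting with \<open>f\<close>, to which
  hyperinvariance applies.\<close>

lemma proj_f: "j \<in> {1..m} \<Longrightarrow> proj j (f x) = f (proj j x)"
proof (rule proj_unique)
  show "f (proj j x) \<in> C j 0" if "j \<in> {1..m}" for j
    using proj_in_C[OF that] by (auto simp: C_def f_mem_cyc)
qed (simp_all only: f.sum[symmetric] sum_proj)

lemma linear_proj: "j \<in> {1..m} \<Longrightarrow> Vector_Spaces.linear scale scale (proj j)"
  by (simp add: Vector_Spaces.linear_iff proj_add proj_scale vector_space_axioms)

lemma proj_funpow: "j \<in> {1..m} \<Longrightarrow> proj j ((f ^^ n) x) = (f ^^ n) (proj j x)"
  by (rule funpow_commute) (simp add: fun_eq_iff proj_f)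

lemma proj_diff: "j \<in> {1..m} \<Longrightarrow> proj j (x - y) = proj j x - proj j y"
  using module_hom.diff[OF linear_proj[unfolded module_hom_iff_linear[symmetric]]] by blast

lemma proj_sum: "j \<in> {1..m} \<Longrightarrow> proj j (sum g S) = (\<Sum>s\<in>S. proj j (g s))"
  using module_hom.sum[OF linear_proj[unfolded module_hom_iff_linear[symmetric]]] by blast

lemma proj_of_C:
  assumes "l \<in> {1..m}" "x \<in> C l 0" "j \<in> {1..m}"
  shows "proj j x = (if j = l then x else 0)"
  by (rule proj_unique) (use assms in \<open>auto intro: subspace_0\<close>)

section \<open>Componentwise description of the subspaces W(r)\<close>

lemma proj_range_ker:
  assumes "j \<in> {1..m}" "x \<in> range (f ^^ a)" "(f ^^ b) x = 0"
  shows "proj j x \<in> C j a" "proj j x \<in> C j (t j - b)"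
proof -
  obtain y where "x = (f ^^ a) y" using assms(2) by blast
  then show "proj j x \<in> C j a"
    using funpow_image_C[of a j 0] proj_in_C[OF assms(1), of y]
    by (auto simp: proj_funpow[OF assms(1)])
  \<comment> \<open>The instance of \<open>proj_scale\<close> with scalar 0 and vector 0 says that
    \<open>proj j 0 = 0\<close>.\<close>
  have "(f ^^ b) (proj j x) = 0"
    using proj_funpow[OF assms(1), of b x] assms(3) proj_scale[OF assms(1), of 0 0] by simp
  then show "proj j x \<in> C j (t j - b)"
    by (rule C_killed[OF assms(1) proj_in_C[OF assms(1)]])
qed

text \<open>Both monotonicity conditions on \<open>r\<close> enter the forward direction. For the
  \<open>l\<close>-th summand and \<open>j \<le> l\<close>, the range condition gives order
  \<open>r l \<ge> r j\<close>; for \<open>j > l\<close>, the kernel condition gives order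
  \<open>t j - (t l - r l) \<ge> r j\<close>. Conversely, \<open>C j (r j)\<close> lies in the
  \<open>j\<close>-th range and kernel.\<close>

lemma W_space_iff:
  assumes r: "r \<in> hyper_tuples m t"
  shows "x \<in> W_space f m t r \<longleftrightarrow> (\<forall>j\<in>{1..m}. proj j x \<in> C j (r j))"
proof
  assume "x \<in> W_space f m t r"
  then obtain s where x: "x = (\<Sum>l\<in>{1..m}. s l)"
    and s: "\<And>l. l \<in> {1..m} \<Longrightarrow> s l \<in> range (f ^^ r l)"
      "\<And>l. l \<in> {1..m} \<Longrightarrow> (f ^^ (t l - r l)) (s l) = 0"
    unfolding W_space_def by (auto simp: set_sum_alt)
  show "\<forall>j\<in>{1..m}. proj j x \<in> C j (r j)"
  proof
    fix j assume j: "j \<in> {1..m}"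
    have "proj j (s l) \<in> C j (r j)" if l: "l \<in> {1..m}" for l
    proof (cases "j \<le> l")
      case True
      then have "r j \<le> r l" using r j l by (auto simp: hyper_tuples_def mono_on_def)
      then show ?thesis using proj_range_ker(1)[OF j s[OF l]] C_antimono by blast
    next
      case False
      then have "t l - r l \<le> t j - r j" "r j \<le> t j"
        using r j l by (auto simp: hyper_tuples_def mono_on_def)
      then have "r j \<le> t j - (t l - r l)" by simp
      then show ?thesis using proj_range_ker(2)[OF j s[OF l]] C_antimono by blast
    qed
    then show "proj j x \<in> C j (r j)"
      unfolding x proj_sum[OF j] by (intro subspace_sum) auto
  qed
next
  assume x: "\<forall>j\<in>{1..m}. proj j x \<in> C j (r j)"
  have "proj j x \<in> range (f ^^ r j) \<inter> {x. (f ^^ (t j - r j)) x = 0}" if j: "j \<in> {1..m}" for j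
  proof -
    have "r j \<le> t j" using r j by (auto simp: hyper_tuples_def)
    then have "(f ^^ (t j - r j)) ` C j (r j) = {0}"
      using j by (simp add: funpow_image_C C_exponent)
    moreover have "C j (r j) \<subseteq> range (f ^^ r j)"
      using funpow_image_C[of "r j" j 0] by auto
    ultimately show ?thesis using x j by blast
  qed
  then show "x \<in> W_space f m t r"
    unfolding W_space_def set_sum_alt[OF finite_atLeastAtMost]
    using sum_proj[of x, symmetric] by (intro CollectI exI[of _ "\<lambda>j. proj j x"]) blast
qed

lemma subspace_W_space:
  assumes "r \<in> hyper_tuples m t"
  shows "subspace (W_space f m t r)"
  by (intro subspaceI)
    (use proj_scale[of _ 0 0] in \<open>auto simp: W_space_iff[OF assms] proj_add proj_scale
      intro: subspace_add subspace_scale subspace_0\<close>)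

end

lemma W_space_commuting:
  assumes "Vector_Spaces.linear scale scale g" "g \<circ> f = f \<circ> g"
    "x \<in> W_space f m t r"
  shows "g x \<in> W_space f m t r"
proof -
  interpret g: Vector_Spaces.linear scale scale g by fact
  have comm: "g ((f ^^ n) x) = (f ^^ n) (g x)" for n x
    using assms(2) by (induction n) (simp_all add: fun_eq_iff)
  obtain s where x: "x = (\<Sum>l\<in>{1..m}. s l)"
    and s: "\<And>l. l \<in> {1..m} \<Longrightarrow> s l \<in> range (f ^^ r l) \<inter> {x. (f ^^ (t l - r l)) x = 0}"
    using assms(3) unfolding W_space_def by (auto simp: set_sum_alt)
  have "g (s l) \<in> range (f ^^ r l) \<inter> {x. (f ^^ (t l - r l)) x = 0}" if "l \<in> {1..m}" for l
    using s[OF that] comm[of "t l - r l" "s l"] by (auto simp: comm)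
  then show ?thesis
    unfolding x g.sum W_space_def by (auto simp: set_sum_alt)
qed

section \<open>Two tuples that differ by one exactly on J\<close>

text \<open>\<open>separated\<close> restates the two strict chains without an enumeration of
  \<open>J\<close>: the first alternative serves indices \<open>j\<close> before \<open>s\<close>,
  the second those after \<open>s\<close>.\<close>

locale hyper_tuple_step = generated_endomorphism scale f m t u
  for scale :: "'a::field \<Rightarrow> 'v::ab_group_add \<Rightarrow> 'v" (infixr \<open>*s\<close> 75)
    and f m t u +
  fixes J :: "nat set" and \<mu> r :: "nat \<Rightarrow> nat"
  assumes J_subset: "J \<subseteq> {1..m}"
    and mu_tuple: "\<mu> \<in> hyper_tuples m t"
    and r_tuple: "r \<in> hyper_tuples m t"
    and r_eq: "\<And>j. j \<in> {1..m} \<Longrightarrow> r j = (if j \<in> J then Suc (\<mu> j) else \<mu> j)"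
    and separated: "\<And>s j. s \<in> J \<Longrightarrow> j \<in> J \<Longrightarrow> j \<noteq> s \<Longrightarrow> \<mu> j < \<mu> s \<or> t s - \<mu> s < t j - \<mu> j"
begin

abbreviation "W_mu \<equiv> W_space f m t \<mu>"
abbreviation "W_r \<equiv> W_space f m t r"

definition d :: "nat \<Rightarrow> 'v" where
  "d s = (f ^^ \<mu> s) (u s)"

lemma J_index: "s \<in> J \<Longrightarrow> s \<in> {1..m}"
  using J_subset by blast

lemma finite_J: "finite J"
  using J_subset finite_subset by blast

lemma mu_less: "s \<in> J \<Longrightarrow> \<mu> s < t s"
  using r_eq[of s] J_index[of s] r_tuple by (force simp: hyper_tuples_def)

lemmas subspace_W_r = subspace_W_space[OF r_tuple]
lemmas subspace_W_mu = subspace_W_space[OF mu_tuple]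

lemma d_in_C: "d s \<in> C s (\<mu> s)"
  by (simp add: d_def generator_in_C)

lemma d_in_C0: "d s \<in> C s 0"
  using d_in_C C_antimono by blast

lemma proj_d: "s \<in> J \<Longrightarrow> j \<in> {1..m} \<Longrightarrow> proj j (d s) = (if j = s then d s else 0)"
  by (simp only: proj_of_C[OF J_index d_in_C0])

lemma proj_combination:
  assumes "T \<subseteq> J" "j \<in> {1..m}"
  shows "proj j (\<Sum>s\<in>T. c s *s d s) = (if j \<in> T then c j *s d j else 0)"
proof -
  have "proj j (c s *s d s) = (if s = j then c s *s d s else 0)" if "s \<in> T" for s
    using that assms by (auto simp: proj_scale proj_d)
  then have "proj j (\<Sum>s\<in>T. c s *s d s) = (\<Sum>s\<in>T. if s = j then c s *s d s else 0)"
    by (simp only: proj_sum[OF assms(2)] cong: sum.cong)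
  then show ?thesis using finite_subset[OF assms(1) finite_J] by simp
qed

lemma d_in_W_mu: "s \<in> J \<Longrightarrow> d s \<in> W_mu"
  unfolding W_space_iff[OF mu_tuple] by (simp add: proj_d d_in_C subspace_0)

lemma W_r_subset: "W_r \<subseteq> W_mu"
proof
  fix x assume "x \<in> W_r"
  moreover have "C j (r j) \<subseteq> C j (\<mu> j)" if "j \<in> {1..m}" for j
    using r_eq[OF that] by (intro C_antimono) auto
  ultimately show "x \<in> W_mu"
    unfolding W_space_iff[OF mu_tuple] W_space_iff[OF r_tuple] by blast
qed

lemma span_subset_W_mu: "T \<subseteq> J \<Longrightarrow> span (d ` T) \<subseteq> W_mu"
  using d_in_W_mu by (intro span_minimal subspace_W_mu) blast

text \<open>\<open>f\<close> raises the order of each component by one, and \<open>r\<close> exceeds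
  \<open>\<mu>\<close> by at most one. Hence \<open>f\<close> induces zero on the quotient of
  \<open>W_mu\<close> by \<open>W_r\<close>.\<close>

lemma f_W_mu: "x \<in> W_mu \<Longrightarrow> f x \<in> W_r"
proof -
  assume x: "x \<in> W_mu"
  have "proj j (f x) \<in> C j (r j)" if j: "j \<in> {1..m}" for j
  proof -
    have "f (proj j x) \<in> C j (Suc (\<mu> j))"
      using x j by (blast intro: f_mem_C dest: W_space_iff[OF mu_tuple, THEN iffD1])
    moreover have "C j (Suc (\<mu> j)) \<subseteq> C j (r j)"
      using r_eq[OF j] by (intro C_antimono) auto
    ultimately show ?thesis using j by (auto simp: proj_f)
  qed
  then show "f x \<in> W_r" using W_space_iff[OF r_tuple] by blast
qed

text \<open>For a combination of the \<open>d s\<close>, the component at \<open>s\<close> is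
  \<open>c s *s d s\<close>. Membership in \<open>W_r\<close> puts it in
  \<open>C s (Suc (\<mu> s))\<close>, so its leading coefficient \<open>c s\<close> is zero.\<close>

lemma span_inter_W_r: "span (d ` J) \<inter> W_r = {0}"
proof -
  have "x = 0" if x: "x \<in> span (d ` J)" "x \<in> W_r" for x
  proof -
    obtain c where c: "x = (\<Sum>s\<in>J. c s *s d s)"
      using in_span_image_finite[OF finite_J x(1)] .
    have "c s = 0" if s: "s \<in> J" for s
    proof -
      have "proj s x = c s *s d s"
        using s J_index[OF s] by (simp add: c proj_combination)
      moreover have "proj s x \<in> C s (Suc (\<mu> s))"
        using bspec[OF x(2)[unfolded W_space_iff[OF r_tuple]] J_index[OF s]] r_eq[OF J_index[OF s]] s
        by simp
      ultimately show ?thesis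
        using C_leading_coeff_zero[OF J_index[OF s] mu_less[OF s]] by (simp add: d_def)
    qed
    then show ?thesis by (simp add: c)
  qed
  then show ?thesis
    using subspace_0[OF subspace_W_r] subspace_0[OF subspace_span[of "d ` J"]] by auto
qed

lemma d_notin_W_r: "s \<in> J \<Longrightarrow> d s \<notin> W_r"
proof
  assume s: "s \<in> J" "d s \<in> W_r"
  then have "d s = 0" using span_inter_W_r span_base[of "d s" "d ` J"] by blast
  then show False
    using funpow_below_exponent[OF J_index[OF s(1)] mu_less[OF s(1)]] by (simp add: d_def)
qed

text \<open>Take \<open>c s\<close> to be the leading coefficient of the component at
  \<open>s\<close>; subtracting the leading terms raises the order exactly at the indices where
  \<open>r\<close> demands one more.\<close>

lemma W_mu_decompose:
  assumes "x \<in> W_mu"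
  obtains c where "x - (\<Sum>s\<in>J. c s *s d s) \<in> W_r"
proof -
  have "\<exists>c. proj s x - c *s d s \<in> C s (Suc (\<mu> s))" if "s \<in> J" for s
    using C_leading_term[of "proj s x" s "\<mu> s"] assms J_index[OF that]
    unfolding W_space_iff[OF mu_tuple] d_def by blast
  then obtain c where c: "\<And>s. s \<in> J \<Longrightarrow> proj s x - c s *s d s \<in> C s (Suc (\<mu> s))" by metis
  have "x - (\<Sum>s\<in>J. c s *s d s) \<in> W_r"
    unfolding W_space_iff[OF r_tuple]
  proof
    fix j assume j: "j \<in> {1..m}"
    show "proj j (x - (\<Sum>s\<in>J. c s *s d s)) \<in> C j (r j)"
      using assms j c[of j] r_eq[OF j]
      by (simp add: proj_diff proj_combination W_space_iff[OF mu_tuple])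
  qed
  then show ?thesis by (rule that)
qed

section \<open>Action of commuting maps modulo W(r)\<close>

text \<open>The image of \<open>d s\<close> stays in \<open>W_mu\<close>, so only components at
  indices in \<open>J\<close> can obstruct. At \<open>s\<close> the leading term is subtracted; at
  any other \<open>j\<close> in \<open>J\<close> the component already has order at least
  \<open>\<mu> j + 1\<close>.\<close>

lemma commuting_d:
  assumes g: "Vector_Spaces.linear scale scale g" "g \<circ> f = f \<circ> g" and s: "s \<in> J"
  obtains c where "g (d s) - c *s d s \<in> W_r"
proof -
  have range: "g (d s) \<in> range (f ^^ \<mu> s)"
    by (simp add: d_def funpow_commute[OF g(2)])
  have "(f ^^ (t s - \<mu> s)) (d s) = 0"
    using mu_less[OF s] J_index[OF s] by (simp add: d_def funpow_add_apply funpow_exponent)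
  then have ker: "(f ^^ (t s - \<mu> s)) (g (d s)) = 0"
    using funpow_commute[OF g(2), of "t s - \<mu> s" "d s"] module_hom.zero[of scale scale g] g(1)
    by (simp add: module_hom_iff_linear)
  have mu: "proj j (g (d s)) \<in> C j (\<mu> j)" if "j \<in> {1..m}" for j
    using W_space_commuting[OF g d_in_W_mu[OF s]] that
    by (simp add: W_space_iff[OF mu_tuple])
  obtain c where c: "proj s (g (d s)) - c *s d s \<in> C s (Suc (\<mu> s))"
    using C_leading_term[OF mu[OF J_index[OF s]]] by (auto simp: d_def)
  have "g (d s) - c *s d s \<in> W_r"
    unfolding W_space_iff[OF r_tuple]
  proof
    fix j assume j: "j \<in> {1..m}"
    have eq: "proj j (g (d s) - c *s d s) = proj j (g (d s)) - (if j = s then c *s d s else 0)"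
      using s j by (simp add: proj_diff proj_scale proj_d)
    consider "j \<notin> J" | "j = s" | "j \<in> J" "j \<noteq> s" by blast
    then show "proj j (g (d s) - c *s d s) \<in> C j (r j)"
    proof cases
      case 1
      then show ?thesis using s mu[OF j] r_eq[OF j] unfolding eq by auto
    next
      case 2
      then show ?thesis using s c r_eq[OF j] unfolding eq by auto
    next
      case 3
      \<comment> \<open>The two alternatives are matched by the two bounds of
        \<open>proj_range_ker\<close>: the first uses that \<open>g (d s)\<close> is in the range of
        \<open>f ^^ \<mu> s\<close>, the second that it is killed by
        \<open>f ^^ (t s - \<mu> s)\<close>.\<close>
      then have "Suc (\<mu> j) \<le> \<mu> s \<or> Suc (\<mu> j) \<le> t j - (t s - \<mu> s)"
        using separated[OF s] by fastforce
      then show ?thesis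
        using 3 proj_range_ker[OF j range ker] C_antimono[of "Suc (\<mu> j)"] r_eq[OF j]
        unfolding eq by auto
    qed
  qed
  then show ?thesis by (rule that)
qed

text \<open>If \<open>c\<close> were 0, then \<open>g (d s)\<close> would lie in \<open>W_r\<close>;
  the inverse of \<open>g\<close> also commutes with \<open>f\<close> and preserves
  \<open>W_r\<close>, so \<open>d s\<close> would lie there too.\<close>

lemma automorphism_d:
  assumes g: "Vector_Spaces.linear scale scale g" "bij g" "g \<circ> f = f \<circ> g" and s: "s \<in> J"
  obtains c where "c \<noteq> 0" "g (d s) - c *s d s \<in> W_r"
proof -
  obtain c where c: "g (d s) - c *s d s \<in> W_r"
    using commuting_d[OF g(1,3) s] .
  have "c \<noteq> 0"
  proof
    assume "c = 0"
    then have gd: "g (d s) \<in> W_r" using c by simp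
    have "Vector_Spaces.linear scale scale (inv g)"
      using bij_module_hom_imp_inv_module_hom[of scale scale g] g
      by (simp add: module_hom_iff_linear)
    moreover have "inv g \<circ> f = f \<circ> inv g"
    proof
      fix x
      have "g (f (inv g x)) = f x"
        using g by (simp add: fun_eq_iff bij_is_surj surj_f_inv_f)
      then show "(inv g \<circ> f) x = (f \<circ> inv g) x"
        using g(2) by (metis bij_inv_eq_iff comp_apply)
    qed
    ultimately have "inv g (g (d s)) \<in> W_r"
      using W_space_commuting[OF _ _ gd] by blast
    then show False using d_notin_W_r[OF s] g(2) by (simp add: bij_is_inj)
  qed
  then show ?thesis using c by (rule that)
qed

section \<open>The interval between W(r) and W(mu) and its hyperinvariant members\<close>

lemma subspace_between_invariant:
  assumes "subspace X" "W_r \<subseteq> X" "X \<subseteq> W_mu"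
  shows "X \<in> inv_interval scale f W_r W_mu"
  using assms f_W_mu by (auto simp: inv_interval_def invariant_subspace_def)

lemma inv_interval_iff:
  "X \<in> inv_interval scale f W_r W_mu \<longleftrightarrow>
    (\<exists>Z. subspace Z \<and> Z \<subseteq> span (d ` J) \<and> direct_sum2 W_r Z X)"
proof
  assume "X \<in> inv_interval scale f W_r W_mu"
  then have X: "subspace X" "W_r \<subseteq> X" "X \<subseteq> W_mu"
    by (auto simp: inv_interval_def invariant_subspace_def)
  let ?Z = "X \<inter> span (d ` J)"
  have Z: "subspace ?Z" using X(1) by (intro subspace_inter) auto
  have "X \<subseteq> W_r + ?Z"
  proof
    fix x assume x: "x \<in> X"
    then obtain c where c: "x - (\<Sum>s\<in>J. c s *s d s) \<in> W_r"
      using X W_mu_decompose by blast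
    let ?y = "\<Sum>s\<in>J. c s *s d s"
    \<comment> \<open>This vector is \<open>?y\<close>: the span part of \<open>x\<close> belongs to
      \<open>X\<close> since the remainder lies in \<open>W_r\<close>, a subspace of
      \<open>X\<close>.\<close>
    have "x - (x - ?y) \<in> X" by (rule subspace_diff[OF X(1) x subsetD[OF X(2) c]])
    moreover have "?y \<in> span (d ` J)"
      by (intro span_sum span_scale span_base) auto
    ultimately have "?y \<in> ?Z" by simp
    with c have "x - ?y + ?y \<in> W_r + ?Z" by (rule set_plus_intro)
    then show "x \<in> W_r + ?Z" by simp
  qed
  moreover have "W_r + ?Z \<subseteq> X"
    using X by (auto elim!: set_plus_elim intro!: subspace_add)
  moreover have "W_r \<inter> ?Z = {0}"
    using span_inter_W_r X subspace_0 by auto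
  ultimately show "\<exists>Z. subspace Z \<and> Z \<subseteq> span (d ` J) \<and> direct_sum2 W_r Z X"
    using Z unfolding direct_sum2_def by blast
next
  assume "\<exists>Z. subspace Z \<and> Z \<subseteq> span (d ` J) \<and> direct_sum2 W_r Z X"
  then obtain Z where Z: "subspace Z" "Z \<subseteq> W_mu" "X = W_r + Z"
    using span_subset_W_mu[of J] unfolding direct_sum2_def by blast
  have "X = {x + y |x y. x \<in> W_r \<and> y \<in> Z}" by (auto simp: Z set_plus_def)
  then have "subspace X" using subspace_sums[OF subspace_W_r Z(1)] by simp
  moreover have "W_r \<subseteq> X"
    using Z subspace_0 by (metis add.right_neutral set_plus_intro subsetI)
  moreover have "X \<subseteq> W_mu"
    using Z W_r_subset by (auto elim!: set_plus_elim intro!: subspace_add[OF subspace_W_mu])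
  ultimately show "X \<in> inv_interval scale f W_r W_mu"
    by (rule subspace_between_invariant)
qed

text \<open>For a hyperinvariant \<open>X\<close>, the set \<open>T\<close> consists of the
  \<open>s\<close> in \<open>J\<close> with \<open>d s \<in> X\<close>. Conversely, by
  \<open>commuting_d\<close> each \<open>d s\<close> with \<open>s \<in> T\<close> is mapped to a
  multiple of itself modulo \<open>W_r\<close>, so commuting maps preserve the sum.\<close>

lemma hyperinvariant_iff:
  assumes "X \<in> inv_interval scale f W_r W_mu"
  shows "hyperinvariant scale f X \<longleftrightarrow> (\<exists>T\<subseteq>J. direct_sum2 W_r (span (d ` T)) X)"
proof
  have X: "subspace X" "W_r \<subseteq> X" "X \<subseteq> W_mu"
    using assms by (auto simp: inv_interval_def invariant_subspace_def)
  {
    assume hyp: "hyperinvariant scale f X"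
    let ?T = "{s \<in> J. d s \<in> X}"
    have T_sub: "span (d ` ?T) \<subseteq> X" using X by (intro span_minimal) auto
    have "X \<subseteq> W_r + span (d ` ?T)"
    proof
      fix x assume x: "x \<in> X"
      then obtain c where c: "x - (\<Sum>s\<in>J. c s *s d s) \<in> W_r"
        using X W_mu_decompose by blast
      let ?y = "\<Sum>s\<in>J. c s *s d s"
      have "x - (x - ?y) \<in> X" by (rule subspace_diff[OF X(1) x subsetD[OF X(2) c]])
      then have y: "?y \<in> X" by simp
      have "c s *s d s \<in> span (d ` ?T)" if s: "s \<in> J" for s
      proof (cases "c s = 0")
        case False
        \<comment> \<open>Projecting \<open>?y\<close> to the summand \<open>s\<close> isolates the
          term \<open>c s *s d s\<close> inside \<open>X\<close>; dividing by the nonzero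
          \<open>c s\<close> then shows \<open>s \<in> ?T\<close>.\<close>
        have "proj s ` X \<subseteq> X"
          using hyp linear_proj[OF J_index[OF s]] proj_f[OF J_index[OF s]]
          by (simp add: hyperinvariant_def fun_eq_iff)
        then have "c s *s d s \<in> X"
          using y s proj_combination[OF order_refl J_index[OF s], of c] by auto
        then have "d s \<in> X"
          using subspace_scale[OF X(1), of "c s *s d s" "inverse (c s)"] False by simp
        with s show ?thesis by (intro span_scale span_base) auto
      qed (simp add: span_zero)
      then have "?y \<in> span (d ` ?T)" by (rule span_sum)
      with c have "x - ?y + ?y \<in> W_r + span (d ` ?T)" by (rule set_plus_intro)
      then show "x \<in> W_r + span (d ` ?T)" by simp
    qed
    moreover have "W_r + span (d ` ?T) \<subseteq> X"
      using X T_sub by (auto elim!: set_plus_elim intro!: subspace_add)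
    moreover have "W_r \<inter> span (d ` ?T) = {0}"
      using span_inter_W_r span_mono[of "d ` ?T" "d ` J"] subspace_0[OF subspace_W_r] span_zero
      by blast
    ultimately show "\<exists>T\<subseteq>J. direct_sum2 W_r (span (d ` T)) X"
      unfolding direct_sum2_def by (intro exI[of _ ?T]) auto
  }
  {
    assume "\<exists>T\<subseteq>J. direct_sum2 W_r (span (d ` T)) X"
    then obtain T where T: "T \<subseteq> J" "X = W_r + span (d ` T)"
      unfolding direct_sum2_def by blast
    have T_sub: "span (d ` T) \<subseteq> X"
      unfolding T(2) using subspace_0[OF subspace_W_r] by (metis add.left_neutral set_plus_intro subsetI)
    have "g ` X \<subseteq> X" if g: "Vector_Spaces.linear scale scale g" "g \<circ> f = f \<circ> g" for g
    proof -
      interpret g: Vector_Spaces.linear scale scale g by fact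
      have "g (d s) \<in> X" if s: "s \<in> T" for s
      proof -
        obtain c where "g (d s) - c *s d s \<in> W_r"
          using commuting_d[OF g] s T(1) by blast
        moreover have "c *s d s \<in> span (d ` T)"
          using s by (intro span_scale span_base) auto
        ultimately have "g (d s) - c *s d s + c *s d s \<in> X"
          unfolding T(2) by (rule set_plus_intro)
        then show ?thesis by simp
      qed
      then have "span (g ` d ` T) \<subseteq> X" by (intro span_minimal X) auto
      then have "g ` span (d ` T) \<subseteq> X" by (simp add: g.span_image)
      moreover have "g ` W_r \<subseteq> X"
        using W_space_commuting[OF g] X(2) by blast
      ultimately have "g (a + b) \<in> X" if "a \<in> W_r" "b \<in> span (d ` T)" for a b
        unfolding g.add using that by (blast intro: subspace_add[OF X(1)])
      then show ?thesis using T(2) by (auto elim!: set_plus_elim)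
    qed
    then show "hyperinvariant scale f X" using X(1) by (simp add: hyperinvariant_def)
  }
qed

end

section \<open>Specialisation to GF(2)\<close>

text \<open>The nonzero scalar of \<open>automorphism_d\<close> can only be 1, so \<open>g\<close>
  fixes each \<open>d s\<close> modulo \<open>W_r\<close>. As \<open>g\<close> also preserves
  \<open>W_r\<close>, the difference \<open>g x - x\<close> lies in \<open>W_r\<close> and hence in
  \<open>X\<close>.\<close>

lemma characteristic_over_bit:
  fixes scale :: "bit \<Rightarrow> 'v::ab_group_add \<Rightarrow> 'v"
  assumes "hyper_tuple_step scale f m t u J \<mu> r"
    and "X \<in> inv_interval scale f (W_space f m t r) (W_space f m t \<mu>)"
  shows "characteristic scale f X"
proof -
  interpret hyper_tuple_step scale f m t u J \<mu> r by fact
  have X: "subspace X" "W_r \<subseteq> X" "X \<subseteq> W_mu"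
    using assms(2) by (auto simp: inv_interval_def invariant_subspace_def)
  have "g ` X \<subseteq> X"
    if g: "Vector_Spaces.linear scale scale g" "bij g" "g \<circ> f = f \<circ> g" for g
  proof
    interpret g: Vector_Spaces.linear scale scale g by fact
    fix y assume "y \<in> g ` X"
    then obtain x where x: "x \<in> X" "y = g x" by blast
    then obtain c where c: "x - (\<Sum>s\<in>J. scale (c s) (d s)) \<in> W_r"
      using X W_mu_decompose by blast
    let ?w = "x - (\<Sum>s\<in>J. scale (c s) (d s))"
    have "g (d s) - d s \<in> W_r" if s: "s \<in> J" for s
    proof -
      obtain a where "a \<noteq> 0" "g (d s) - scale a (d s) \<in> W_r"
        using automorphism_d[OF g s] .
      then show ?thesis by (simp add: bit_not_zero_iff)
    qed
    then have "(\<Sum>s\<in>J. scale (c s) (g (d s) - d s)) \<in> W_r"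
      by (intro subspace_sum subspace_scale subspace_W_r)
    moreover have "g ?w - ?w \<in> W_r"
      by (rule subspace_diff[OF subspace_W_r W_space_commuting[OF g(1,3) c] c])
    ultimately have "g ?w - ?w + (\<Sum>s\<in>J. scale (c s) (g (d s) - d s)) \<in> W_r"
      by (intro subspace_add subspace_W_r)
    also have "g ?w - ?w + (\<Sum>s\<in>J. scale (c s) (g (d s) - d s)) = g x - x"
      by (simp add: g.diff g.sum g.scale scale_right_diff_distrib sum_subtractf)
    finally have "g x - x + x \<in> X"
      using X x by (intro subspace_add) auto
    then show "y \<in> X" by (simp add: x)
  qed
  then show ?thesis
    using assms(2) by (simp add: characteristic_def inv_interval_def)
qed

theorem theorem3p3:
  fixes scale :: "bit \<Rightarrow> 'v::ab_group_add \<Rightarrow> 'v"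
    and Basis :: "'v set"
    and f :: "'v \<Rightarrow> 'v"
    and m k :: nat
    and t \<mu> r i :: "nat \<Rightarrow> nat"
    and u :: "nat \<Rightarrow> 'v"
    and J :: "nat set"
    and D :: "'v set"
  assumes "finite_dimensional_vector_space scale Basis"
    and "Vector_Spaces.linear scale scale f"
    and "nilpotent f"
    and "elementary_divisors scale f m (\<lambda>j. monom 1 (t j))"
    and "\<forall>j\<in>{1..m}. 0 < t j"
    and "mono_on {1..m} t"
    and "generator_tuple scale f m t u"
    and "2 \<le> k"
    and "strict_mono_on {1..k} i"
    and "J = i ` {1..k}"
    and "J \<subseteq> unrepeated m t"
    and "\<forall>s\<in>{1..<k}. t (i s) + 1 < t (i (s + 1))"
    and "\<mu> \<in> hyper_tuples m t"
    and "r \<in> hyper_tuples m t"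
    and "strict_mono_on {1..k} (\<lambda>s. \<mu> (i s))"
    and "0 < t (i 1) - \<mu> (i 1)"
    and "strict_mono_on {1..k} (\<lambda>s. t (i s) - \<mu> (i s))"
    and "\<forall>j\<in>{1..m}. r j = \<mu> j + (\<Sum>s\<in>{1..k}. unit_tuple (i s) j)"
    and "D = module.span scale ((\<lambda>s. (f ^^ \<mu> (i s)) (u (i s))) ` {1..k})"
  shows
    "(\<forall>X \<in> inv_interval scale f (W_space f m t r) (W_space f m t \<mu>). characteristic scale f X) \<and>
     (\<forall>X. X \<in> inv_interval scale f (W_space f m t r) (W_space f m t \<mu>) \<longleftrightarrow>
          (\<exists>Z. module.subspace scale Z \<and> Z \<subseteq> D \<and> direct_sum2 (W_space f m t r) Z X)) \<and>
     (\<forall>X \<in> inv_interval scale f (W_space f m t r) (W_space f m t \<mu>).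
          hyperinvariant scale f X \<longleftrightarrow>
          (\<exists>T \<subseteq> J. direct_sum2 (W_space f m t r)
                     (module.span scale ((\<lambda>\<tau>. (f ^^ \<mu> \<tau>) (u \<tau>)) ` T)) X))"
proof -
  have inj: "inj_on i {1..k}"
    using assms(9) by (rule strict_mono_on_imp_inj_on)
  interpret finite_dimensional_vector_space scale Basis by fact
  interpret f: Vector_Spaces.linear scale scale f by fact
  have "hyper_tuple_step scale f m t u J \<mu> r"
  proof (unfold_locales)
    show "J \<subseteq> {1..m}" using assms(11) by (auto simp: unrepeated_def)
    show "r j = (if j \<in> J then Suc (\<mu> j) else \<mu> j)" if "j \<in> {1..m}" for j
    proof -
      \<comment> \<open>Injectivity of \<open>i\<close> ensures that each index of \<open>J\<close>
        is counted once, so the sum is 1 on \<open>J\<close> and 0 elsewhere.\<close>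
      have "(\<Sum>s\<in>{1..k}. unit_tuple (i s) j) = (\<Sum>l\<in>J. unit_tuple l j)"
        unfolding assms(10) by (simp only: sum.reindex[OF inj] comp_def)
      then show ?thesis
        using assms(18) that by (simp add: unit_tuple_def assms(10))
    qed
    show "\<mu> j < \<mu> s \<or> t s - \<mu> s < t j - \<mu> j" if sj: "s \<in> J" "j \<in> J" "j \<noteq> s" for s j
    proof -
      obtain a b where ab: "s = i a" "j = i b" "a \<in> {1..k}" "b \<in> {1..k}"
        using sj(1,2) assms(10) by blast
      \<comment> \<open>If \<open>b < a\<close>, the chain for \<open>\<mu>\<close> gives the first
        alternative; if \<open>a < b\<close>, the chain for \<open>t - \<mu>\<close> gives the
        second.\<close>
      with sj(3) have "a < b \<or> b < a" by (metis linorder_neqE)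
      then show ?thesis
        using ab strict_mono_onD[OF assms(15)] strict_mono_onD[OF assms(17)] by blast
    qed
  qed (fact assms)+
  then interpret hyper_tuple_step scale f m t u J \<mu> r .
  have "D = span (d ` J)"
    by (simp add: assms(10,19) image_image d_def)
  then show ?thesis
    using characteristic_over_bit[OF hyper_tuple_step_axioms] inv_interval_iff hyperinvariant_iff
    by (simp add: d_def)
qed

end
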